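(* Let $X,Y$ be sets, let $a\in\mathcal{PT}_{YX}$ be a partial function from $Y$ to $X$, and let $\mathcal{PT}_{XY}^a=(\mathcal{PT}_{XY},\star_a)$ be the sandwich semigroup with $f\star_a g=fag$. For $f\in\mathcal{PT}_{XY}$: (i) $R_f^a=R_f\cap P_1^a$ if $f\in P_1^a$, and $R_f^a=\{f\}$ if $f\notin P_1^a$; (ii) $L_f^a=L_f\cap P_2^a$ if $f\in P_2^a$, and $L_f^a=\{f\}$ if $f\notin P_2^a$; (iii) $H_f^a=H_f$ if $f\in P^a$, and $H_f^a=\{f\}$ if $f\notin P^a$; (iv) $D_f^a=D_f\cap P^a$ if $f\in P^a$; $D_f^a=L_f^a$ if $f\in P_2^a\setminus P_1^a$; $D_f^a=R_f^a$ if $f\in P_1^a\setminus P_2^a$; and $D_f^a=\{f\}$ if $f\notin P_1^a\cup P_2^a$; (v) $J_f^a=J_f\cap P_3^a$ if $f\in P_3^a$, and $J_f^a=D_f^a$ if $f\notin P_3^a$. Further, if $f\notin P^a$, then $H_f^a=\{f\}$ is a non-group $\mathscr H^a$-class of $\mathcal{PT}_{XY}^a$.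
   Context: Maps are written on the right and composed left to right. $\mathcal{PT}_{CD}$ is the set of all partial functions from the set $C$ to the set $D$ (regarded as morphisms $C\to D$ of the category $\mathcal{PT}$ of sets and partial functions). Green's relations of the category $\mathcal{PT}$: for morphisms $x,y$, $x\leq_{\mathscr R}y$ if $x=yu$, $x\leq_{\mathscr L}y$ if $x=uy$, $x\leq_{\mathscr J}y$ if $x=uyv$, for some morphisms $u,v$ of $\mathcal{PT}$ (with products defined); $\mathscr R,\mathscr L,\mathscr J$ are the associated equivalences, $\mathscr H=\mathscr R\cap\mathscr L$, and $\mathscr D=\mathscr R\circ\mathscr L$. For $f\in\mathcal{PT}_{XY}$ and $\mathscr K\in\{\mathscr R,\mathscr L,\mathscr H,\mathscr D,\mathscr J\}$, $K_f=\{g\in\mathcal{PT}_{XY}: g\mathrel{\mathscr K}f\}$. Green's relations of the semigroup $\mathcal{PT}_{XY}^a$ are denoted $\mathscr R^a,\mathscr L^a,\mathscr H^a,\mathscr D^a,\mathscr J^a$, and $K_f^a$ denotes the $\mathscr K^a$-class of $f$. Moreover $$P_1^a=\{f\in\mathcal{PT}_{XY}: fa\mathrel{\mathscr R}f\},\quad P_2^a=\{f\in\mathcal{PT}_{XY}: af\mathrel{\mathscr L}f\},\quad P_3^a=\{f\in\mathcal{PT}_{XY}: afa\mathrel{\mathscr J}f\},\quad P^a=P_1^a\cap P_2^a,$$ where $\mathscr R,\mathscr L,\mathscr J$ are those of the category $\mathcal{PT}$. *)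

theory Defs
  imports "HOL-Algebra.Group"
begin

section \<open>The category of sets and partial functions\<close>

definition PT :: "'a set \<Rightarrow> 'b set \<Rightarrow> ('a \<rightharpoonup> 'b) set" where
  "PT C D = {f. dom f \<subseteq> C \<and> ran f \<subseteq> D}"

text \<open>Maps are written on the right: first \<open>f\<close>, then \<open>g\<close>.\<close>

definition pcomp :: "('a \<rightharpoonup> 'b) \<Rightarrow> ('b \<rightharpoonup> 'c) \<Rightarrow> ('a \<rightharpoonup> 'c)"  (infixl "\<cdot>" 70) where
  "f \<cdot> g = g \<circ>\<^sub>m f"

text \<open>
  Morphisms do not carry their domain and codomain, so the Green relations of the category take
  as arguments the objects between which the multipliers run:

  \<^item> \<open>cat_R B D\<close> relates \<open>x : A \<rightarrow> B\<close> and \<open>y : A \<rightarrow> D\<close> (the common domain \<open>A\<close> is irrelevant);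
  \<^item> \<open>cat_L A C\<close> relates \<open>x : A \<rightarrow> B\<close> and \<open>y : C \<rightarrow> B\<close> (the common codomain \<open>B\<close> is irrelevant);
  \<^item> \<open>cat_J A B C D\<close> and \<open>cat_D A B C D\<close> relate \<open>x : A \<rightarrow> B\<close> and \<open>y : C \<rightarrow> D\<close>.

  In \<open>x = y u\<close>, \<open>x = u y\<close> and \<open>x = u y v\<close> the objects of \<open>u\<close> and \<open>v\<close> are determined by those of
  \<open>x\<close> and \<open>y\<close>. Likewise, in \<open>x R z L y\<close> the morphism \<open>z\<close> has the domain of \<open>x\<close> and the
  codomain of \<open>y\<close>. The category has identities, so no identity needs to be adjoined.
\<close>

definition cat_le_R :: "'b set \<Rightarrow> 'd set \<Rightarrow> ('a \<rightharpoonup> 'b) \<Rightarrow> ('a \<rightharpoonup> 'd) \<Rightarrow> bool" where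
  "cat_le_R B D x y \<longleftrightarrow> (\<exists>u\<in>PT D B. x = y \<cdot> u)"

definition cat_le_L :: "'a set \<Rightarrow> 'c set \<Rightarrow> ('a \<rightharpoonup> 'b) \<Rightarrow> ('c \<rightharpoonup> 'b) \<Rightarrow> bool" where
  "cat_le_L A C x y \<longleftrightarrow> (\<exists>u\<in>PT A C. x = u \<cdot> y)"

definition cat_le_J ::
  "'a set \<Rightarrow> 'b set \<Rightarrow> 'c set \<Rightarrow> 'd set \<Rightarrow> ('a \<rightharpoonup> 'b) \<Rightarrow> ('c \<rightharpoonup> 'd) \<Rightarrow> bool" where
  "cat_le_J A B C D x y \<longleftrightarrow> (\<exists>u\<in>PT A C. \<exists>v\<in>PT D B. x = u \<cdot> y \<cdot> v)"

definition cat_R :: "'b set \<Rightarrow> 'd set \<Rightarrow> ('a \<rightharpoonup> 'b) \<Rightarrow> ('a \<rightharpoonup> 'd) \<Rightarrow> bool" where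
  "cat_R B D x y \<longleftrightarrow> cat_le_R B D x y \<and> cat_le_R D B y x"

definition cat_L :: "'a set \<Rightarrow> 'c set \<Rightarrow> ('a \<rightharpoonup> 'b) \<Rightarrow> ('c \<rightharpoonup> 'b) \<Rightarrow> bool" where
  "cat_L A C x y \<longleftrightarrow> cat_le_L A C x y \<and> cat_le_L C A y x"

definition cat_J ::
  "'a set \<Rightarrow> 'b set \<Rightarrow> 'c set \<Rightarrow> 'd set \<Rightarrow> ('a \<rightharpoonup> 'b) \<Rightarrow> ('c \<rightharpoonup> 'd) \<Rightarrow> bool" where
  "cat_J A B C D x y \<longleftrightarrow> cat_le_J A B C D x y \<and> cat_le_J C D A B y x"

definition cat_D ::
  "'a set \<Rightarrow> 'b set \<Rightarrow> 'c set \<Rightarrow> 'd set \<Rightarrow> ('a \<rightharpoonup> 'b) \<Rightarrow> ('c \<rightharpoonup> 'd) \<Rightarrow> bool" where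
  "cat_D A B C D x y \<longleftrightarrow> (\<exists>z\<in>PT A D. cat_R B D x z \<and> cat_L A C z y)"

definition cat_R_class :: "'a set \<Rightarrow> 'b set \<Rightarrow> ('a \<rightharpoonup> 'b) \<Rightarrow> ('a \<rightharpoonup> 'b) set" where
  "cat_R_class X Y f = {g \<in> PT X Y. cat_R Y Y g f}"

definition cat_L_class :: "'a set \<Rightarrow> 'b set \<Rightarrow> ('a \<rightharpoonup> 'b) \<Rightarrow> ('a \<rightharpoonup> 'b) set" where
  "cat_L_class X Y f = {g \<in> PT X Y. cat_L X X g f}"

definition cat_H_class :: "'a set \<Rightarrow> 'b set \<Rightarrow> ('a \<rightharpoonup> 'b) \<Rightarrow> ('a \<rightharpoonup> 'b) set" where
  "cat_H_class X Y f = {g \<in> PT X Y. cat_R Y Y g f \<and> cat_L X X g f}"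

definition cat_D_class :: "'a set \<Rightarrow> 'b set \<Rightarrow> ('a \<rightharpoonup> 'b) \<Rightarrow> ('a \<rightharpoonup> 'b) set" where
  "cat_D_class X Y f = {g \<in> PT X Y. cat_D X Y X Y g f}"

definition cat_J_class :: "'a set \<Rightarrow> 'b set \<Rightarrow> ('a \<rightharpoonup> 'b) \<Rightarrow> ('a \<rightharpoonup> 'b) set" where
  "cat_J_class X Y f = {g \<in> PT X Y. cat_J X Y X Y g f}"


section \<open>Green's relations of a semigroup\<close>

text \<open>
  The semigroup has carrier \<open>S\<close> and multiplication \<open>m\<close>. Multipliers range over \<open>S\<close> with an
  identity adjoined, whence the additional disjuncts.
\<close>

definition sg_le_R :: "'s set \<Rightarrow> ('s \<Rightarrow> 's \<Rightarrow> 's) \<Rightarrow> 's \<Rightarrow> 's \<Rightarrow> bool" where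
  "sg_le_R S m x y \<longleftrightarrow> x = y \<or> (\<exists>u\<in>S. x = m y u)"

definition sg_le_L :: "'s set \<Rightarrow> ('s \<Rightarrow> 's \<Rightarrow> 's) \<Rightarrow> 's \<Rightarrow> 's \<Rightarrow> bool" where
  "sg_le_L S m x y \<longleftrightarrow> x = y \<or> (\<exists>u\<in>S. x = m u y)"

definition sg_le_J :: "'s set \<Rightarrow> ('s \<Rightarrow> 's \<Rightarrow> 's) \<Rightarrow> 's \<Rightarrow> 's \<Rightarrow> bool" where
  "sg_le_J S m x y \<longleftrightarrow>
     x = y \<or> (\<exists>u\<in>S. x = m u y) \<or> (\<exists>v\<in>S. x = m y v) \<or> (\<exists>u\<in>S. \<exists>v\<in>S. x = m (m u y) v)"

definition sg_R :: "'s set \<Rightarrow> ('s \<Rightarrow> 's \<Rightarrow> 's) \<Rightarrow> 's \<Rightarrow> 's \<Rightarrow> bool" where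
  "sg_R S m x y \<longleftrightarrow> sg_le_R S m x y \<and> sg_le_R S m y x"

definition sg_L :: "'s set \<Rightarrow> ('s \<Rightarrow> 's \<Rightarrow> 's) \<Rightarrow> 's \<Rightarrow> 's \<Rightarrow> bool" where
  "sg_L S m x y \<longleftrightarrow> sg_le_L S m x y \<and> sg_le_L S m y x"

definition sg_J :: "'s set \<Rightarrow> ('s \<Rightarrow> 's \<Rightarrow> 's) \<Rightarrow> 's \<Rightarrow> 's \<Rightarrow> bool" where
  "sg_J S m x y \<longleftrightarrow> sg_le_J S m x y \<and> sg_le_J S m y x"

definition sg_D :: "'s set \<Rightarrow> ('s \<Rightarrow> 's \<Rightarrow> 's) \<Rightarrow> 's \<Rightarrow> 's \<Rightarrow> bool" where
  "sg_D S m x y \<longleftrightarrow> (\<exists>z\<in>S. sg_R S m x z \<and> sg_L S m z y)"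


section \<open>The sandwich semigroup\<close>

definition sandwich :: "('b \<rightharpoonup> 'a) \<Rightarrow> ('a \<rightharpoonup> 'b) \<Rightarrow> ('a \<rightharpoonup> 'b) \<Rightarrow> ('a \<rightharpoonup> 'b)" where
  "sandwich a f g = f \<cdot> a \<cdot> g"

lemma pcomp_PT: "f \<in> PT A B \<Longrightarrow> g \<in> PT B C \<Longrightarrow> f \<cdot> g \<in> PT A C"
  unfolding PT_def pcomp_def
  by (auto simp: map_comp_Some_iff dom_def ran_def)

lemma pcomp_assoc: "f \<cdot> g \<cdot> h = f \<cdot> (g \<cdot> h)"
  unfolding pcomp_def by (auto simp: map_comp_def split: option.splits)

lemma sandwich_closed:
  "a \<in> PT Y X \<Longrightarrow> f \<in> PT X Y \<Longrightarrow> g \<in> PT X Y \<Longrightarrow> sandwich a f g \<in> PT X Y"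
  unfolding sandwich_def by (intro pcomp_PT)

lemma sandwich_assoc: "sandwich a (sandwich a f g) h = sandwich a f (sandwich a g h)"
  unfolding sandwich_def by (simp add: pcomp_assoc)

definition sand_R_class ::
  "'a set \<Rightarrow> 'b set \<Rightarrow> ('b \<rightharpoonup> 'a) \<Rightarrow> ('a \<rightharpoonup> 'b) \<Rightarrow> ('a \<rightharpoonup> 'b) set" where
  "sand_R_class X Y a f = {g \<in> PT X Y. sg_R (PT X Y) (sandwich a) g f}"

definition sand_L_class ::
  "'a set \<Rightarrow> 'b set \<Rightarrow> ('b \<rightharpoonup> 'a) \<Rightarrow> ('a \<rightharpoonup> 'b) \<Rightarrow> ('a \<rightharpoonup> 'b) set" where
  "sand_L_class X Y a f = {g \<in> PT X Y. sg_L (PT X Y) (sandwich a) g f}"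

definition sand_H_class ::
  "'a set \<Rightarrow> 'b set \<Rightarrow> ('b \<rightharpoonup> 'a) \<Rightarrow> ('a \<rightharpoonup> 'b) \<Rightarrow> ('a \<rightharpoonup> 'b) set" where
  "sand_H_class X Y a f =
     {g \<in> PT X Y. sg_R (PT X Y) (sandwich a) g f \<and> sg_L (PT X Y) (sandwich a) g f}"

definition sand_D_class ::
  "'a set \<Rightarrow> 'b set \<Rightarrow> ('b \<rightharpoonup> 'a) \<Rightarrow> ('a \<rightharpoonup> 'b) \<Rightarrow> ('a \<rightharpoonup> 'b) set" where
  "sand_D_class X Y a f = {g \<in> PT X Y. sg_D (PT X Y) (sandwich a) g f}"

definition sand_J_class ::
  "'a set \<Rightarrow> 'b set \<Rightarrow> ('b \<rightharpoonup> 'a) \<Rightarrow> ('a \<rightharpoonup> 'b) \<Rightarrow> ('a \<rightharpoonup> 'b) set" where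
  "sand_J_class X Y a f = {g \<in> PT X Y. sg_J (PT X Y) (sandwich a) g f}"

definition P1 :: "'a set \<Rightarrow> 'b set \<Rightarrow> ('b \<rightharpoonup> 'a) \<Rightarrow> ('a \<rightharpoonup> 'b) set" where
  "P1 X Y a = {f \<in> PT X Y. cat_R X Y (f \<cdot> a) f}"

definition P2 :: "'a set \<Rightarrow> 'b set \<Rightarrow> ('b \<rightharpoonup> 'a) \<Rightarrow> ('a \<rightharpoonup> 'b) set" where
  "P2 X Y a = {f \<in> PT X Y. cat_L Y X (a \<cdot> f) f}"

definition P3 :: "'a set \<Rightarrow> 'b set \<Rightarrow> ('b \<rightharpoonup> 'a) \<Rightarrow> ('a \<rightharpoonup> 'b) set" where
  "P3 X Y a = {f \<in> PT X Y. cat_J Y X X Y (a \<cdot> f \<cdot> a) f}"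

definition P :: "'a set \<Rightarrow> 'b set \<Rightarrow> ('b \<rightharpoonup> 'a) \<Rightarrow> ('a \<rightharpoonup> 'b) set" where
  "P X Y a = P1 X Y a \<inter> P2 X Y a"

definition is_group_under :: "'s set \<Rightarrow> ('s \<Rightarrow> 's \<Rightarrow> 's) \<Rightarrow> bool" where
  "is_group_under K m \<longleftrightarrow> (\<exists>e. group \<lparr>carrier = K, mult = m, one = e\<rparr>)"

end

theory Submission
  imports Defs
begin

text \<open>
  Unfolding the definitions, \<open>f\<close> lies in \<open>P1\<close>, \<open>P2\<close>, \<open>P3\<close> iff \<open>f = f a w\<close>, \<open>f = w a f\<close>,
  \<open>f = u a f a v\<close>, respectively, is solvable in \<open>PT X Y\<close>. For \<open>f \<in> P1\<close> an equation \<open>g = f u\<close> can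
  therefore be rewritten as \<open>g = f a (w u)\<close>, which turns multipliers of the category into
  multipliers of the sandwich semigroup; conversely, two distinct related elements of the
  semigroup give such equations by substituting one relation into the other. Everything else
  follows because \<open>P1\<close> is closed under the category's \<open>\<L>\<close> and \<open>P2\<close> under its \<open>\<R>\<close>, and because
  for \<open>f \<notin> P3\<close> the multipliers linking \<open>f\<close> to a \<open>\<J>\<close>-equivalent element are all trivial on
  the left or all trivial on the right.
\<close>

section \<open>Identity morphisms: the restrictions of \<open>Some\<close> to the objects\<close>

lemma Some_restrict_PT: "Some |` A \<in> PT A A"
  by (auto simp: PT_def ran_def restrict_map_def split: if_splits)

lemma Some_restrict_pcomp:
  assumes "f \<in> PT A B"
  shows "Some |` A \<cdot> f = f"
proof
  fix x
  have "x \<in> A \<or> f x = None" using assms by (auto simp: PT_def dom_def)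
  then show "(Some |` A \<cdot> f) x = f x" by (auto simp: pcomp_def map_comp_def restrict_map_def)
qed

lemma pcomp_Some_restrict: "f \<in> PT A B \<Longrightarrow> f \<cdot> Some |` B = f"
  by (rule ext)
    (auto simp: PT_def pcomp_def map_comp_def restrict_map_def ran_def split: option.splits)

lemma cat_R_refl: "f \<in> PT X Y \<Longrightarrow> cat_R Y Y f f"
  unfolding cat_R_def cat_le_R_def by (metis pcomp_Some_restrict Some_restrict_PT)

lemma cat_L_refl: "f \<in> PT X Y \<Longrightarrow> cat_L X X f f"
  unfolding cat_L_def cat_le_L_def by (metis Some_restrict_pcomp Some_restrict_PT)

text \<open>The missing left multiplier is the identity on \<open>X\<close>.\<close>

lemma cat_le_R_imp_J: "g \<in> PT X Y \<Longrightarrow> f \<in> PT X Y \<Longrightarrow> cat_le_R Y Y g f \<Longrightarrow> cat_le_J X Y X Y g f"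
  unfolding cat_le_R_def cat_le_J_def by (metis Some_restrict_pcomp Some_restrict_PT)

lemma cat_le_L_imp_J: "g \<in> PT X Y \<Longrightarrow> f \<in> PT X Y \<Longrightarrow> cat_le_L X X g f \<Longrightarrow> cat_le_J X Y X Y g f"
  unfolding cat_le_L_def cat_le_J_def by (metis pcomp_Some_restrict Some_restrict_PT)

section \<open>Membership in \<open>P1\<close>, \<open>P2\<close>, \<open>P3\<close> as solvability
  of equations\<close>

context
  fixes X :: "'a set" and Y :: "'b set" and a :: "'b \<rightharpoonup> 'a"
  assumes a: "a \<in> PT Y X"
begin

text \<open>Half of \<open>cat_R\<close> is automatic: \<open>f \<cdot> a\<close> lies below
  \<open>f\<close> through the multiplier \<open>a\<close> itself, so only the converse inequality
  remains as a condition.\<close>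

lemma P1_iff: "f \<in> P1 X Y a \<longleftrightarrow> f \<in> PT X Y \<and> (\<exists>w\<in>PT X Y. f = f \<cdot> a \<cdot> w)"
  using a by (auto simp: P1_def cat_R_def cat_le_R_def)

lemma P2_iff: "f \<in> P2 X Y a \<longleftrightarrow> f \<in> PT X Y \<and> (\<exists>w\<in>PT X Y. f = w \<cdot> a \<cdot> f)"
  using a by (auto simp: P2_def cat_L_def cat_le_L_def pcomp_assoc)

lemma P3_iff:
  "f \<in> P3 X Y a \<longleftrightarrow> f \<in> PT X Y \<and> (\<exists>u\<in>PT X Y. \<exists>v\<in>PT X Y. f = u \<cdot> a \<cdot> f \<cdot> a \<cdot> v)"
  using a by (auto simp: P3_def cat_J_def cat_le_J_def pcomp_assoc)

lemma P1I: "f \<in> PT X Y \<Longrightarrow> w \<in> PT X Y \<Longrightarrow> f = f \<cdot> a \<cdot> w \<Longrightarrow> f \<in> P1 X Y a"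
  unfolding P1_iff by blast

lemma P2I: "f \<in> PT X Y \<Longrightarrow> w \<in> PT X Y \<Longrightarrow> f = w \<cdot> a \<cdot> f \<Longrightarrow> f \<in> P2 X Y a"
  unfolding P2_iff by blast

lemma P3I:
  "f \<in> PT X Y \<Longrightarrow> u \<in> PT X Y \<Longrightarrow> v \<in> PT X Y \<Longrightarrow> f = u \<cdot> a \<cdot> f \<cdot> a \<cdot> v \<Longrightarrow> f \<in> P3 X Y a"
  unfolding P3_iff by blast

lemma pcomp3_PT: "f \<in> PT X Y \<Longrightarrow> g \<in> PT X Y \<Longrightarrow> f \<cdot> a \<cdot> g \<in> PT X Y"
  using sandwich_closed[OF a] by (simp add: sandwich_def)

text \<open>Multiplying \<open>f = f \<cdot> a \<cdot> w\<close> by \<open>u\<close> on the left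
  turns it into the equation for \<open>u \<cdot> f\<close>, with the same witness
  \<open>w\<close>.\<close>

lemma P1_cat_le_L:
  assumes "g \<in> PT X Y" and "cat_le_L X X g f" and "f \<in> P1 X Y a"
  shows "g \<in> P1 X Y a"
proof -
  from assms obtain u w where "g = u \<cdot> f" and w: "w \<in> PT X Y" "f = f \<cdot> a \<cdot> w"
    by (auto simp: cat_le_L_def P1_iff)
  then have "g = g \<cdot> a \<cdot> w" by (metis pcomp_assoc)
  with assms(1) w(1) show ?thesis by (rule P1I)
qed

lemma P2_cat_le_R:
  assumes "g \<in> PT X Y" and "cat_le_R Y Y g f" and "f \<in> P2 X Y a"
  shows "g \<in> P2 X Y a"
proof -
  from assms obtain u w where "g = f \<cdot> u" and w: "w \<in> PT X Y" "f = w \<cdot> a \<cdot> f"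
    by (auto simp: cat_le_R_def P2_iff)
  then have "g = w \<cdot> a \<cdot> g" by (metis pcomp_assoc)
  with assms(1) w(1) show ?thesis by (rule P2I)
qed

lemma P1_cat_L: "g \<in> PT X Y \<Longrightarrow> f \<in> PT X Y \<Longrightarrow> cat_L X X g f \<Longrightarrow> g \<in> P1 X Y a \<longleftrightarrow> f \<in> P1 X Y a"
  by (auto simp: cat_L_def intro: P1_cat_le_L)

lemma P2_cat_R: "g \<in> PT X Y \<Longrightarrow> f \<in> PT X Y \<Longrightarrow> cat_R Y Y g f \<Longrightarrow> g \<in> P2 X Y a \<longleftrightarrow> f \<in> P2 X Y a"
  by (auto simp: cat_R_def intro: P2_cat_le_R)

section \<open>Comparison of the sandwich preorders with those of the category\<close>

lemma sandwich_le_R_iff: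
  "sg_le_R (PT X Y) (sandwich a) g f \<longleftrightarrow> g = f \<or> (\<exists>u\<in>PT X Y. g = f \<cdot> a \<cdot> u)"
  by (simp add: sg_le_R_def sandwich_def)

lemma sandwich_le_L_iff:
  "sg_le_L (PT X Y) (sandwich a) g f \<longleftrightarrow> g = f \<or> (\<exists>u\<in>PT X Y. g = u \<cdot> a \<cdot> f)"
  by (simp add: sg_le_L_def sandwich_def)

text \<open>The equality disjunct is absorbed by the left preorder, so three cases remain instead of
  four.\<close>

lemma sandwich_le_J_cases:
  assumes "sg_le_J (PT X Y) (sandwich a) g f"
  obtains "sg_le_L (PT X Y) (sandwich a) g f"
  | "sg_le_R (PT X Y) (sandwich a) g f"
  | u v where "u \<in> PT X Y" "v \<in> PT X Y" "g = u \<cdot> a \<cdot> f \<cdot> a \<cdot> v"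
  using assms by (auto simp: sg_le_J_def sandwich_le_L_iff sandwich_le_R_iff sandwich_def)

lemma sandwich_le_R_imp_cat:
  assumes "f \<in> PT X Y" and "sg_le_R (PT X Y) (sandwich a) g f"
  shows "cat_le_R Y Y g f"
proof -
  from assms(2) consider "g = f" | u where "u \<in> PT X Y" "g = f \<cdot> (a \<cdot> u)"
    by (auto simp: sandwich_le_R_iff pcomp_assoc)
  then show ?thesis
  proof cases
    case 1
    then show ?thesis using cat_R_refl[OF assms(1)] by (simp add: cat_R_def)
  qed (use a in \<open>auto simp: cat_le_R_def intro: pcomp_PT\<close>)
qed

lemma sandwich_le_L_imp_cat:
  assumes "f \<in> PT X Y" and "sg_le_L (PT X Y) (sandwich a) g f"
  shows "cat_le_L X X g f"
proof -
  from assms(2) consider "g = f" | u where "u \<in> PT X Y" "g = (u \<cdot> a) \<cdot> f"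
    by (auto simp: sandwich_le_L_iff)
  then show ?thesis
  proof cases
    case 1
    then show ?thesis using cat_L_refl[OF assms(1)] by (simp add: cat_L_def)
  qed (use a in \<open>auto simp: cat_le_L_def intro: pcomp_PT\<close>)
qed

lemma sandwich_le_J_imp_cat:
  assumes "g \<in> PT X Y" and "f \<in> PT X Y" and "sg_le_J (PT X Y) (sandwich a) g f"
  shows "cat_le_J X Y X Y g f"
  using assms(3)
proof (cases rule: sandwich_le_J_cases)
  case (3 u v)
  then have "g = (u \<cdot> a) \<cdot> f \<cdot> (a \<cdot> v)" by (simp add: pcomp_assoc)
  with 3 a show ?thesis unfolding cat_le_J_def by (blast intro: pcomp_PT)
qed (use assms sandwich_le_L_imp_cat sandwich_le_R_imp_cat cat_le_L_imp_J cat_le_R_imp_J in blast)+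

text \<open>The upper element \<open>f\<close> carries the hypothesis because its factorisation is
  what gets inserted in front of \<open>u\<close>; \<open>g\<close> may lie outside
  \<open>P1\<close>.\<close>

lemma cat_le_R_imp_sandwich:
  assumes "f \<in> P1 X Y a" and "cat_le_R Y Y g f"
  shows "sg_le_R (PT X Y) (sandwich a) g f"
proof -
  from assms obtain u w where u: "u \<in> PT Y Y" "g = f \<cdot> u" and w: "w \<in> PT X Y" "f = f \<cdot> a \<cdot> w"
    by (auto simp: cat_le_R_def P1_iff)
  then have "g = f \<cdot> a \<cdot> (w \<cdot> u)" by (metis pcomp_assoc)
  with u w show ?thesis unfolding sandwich_le_R_iff by (blast intro: pcomp_PT)
qed

lemma cat_le_L_imp_sandwich:
  assumes "f \<in> P2 X Y a" and "cat_le_L X X g f"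
  shows "sg_le_L (PT X Y) (sandwich a) g f"
proof -
  from assms obtain u w where u: "u \<in> PT X X" "g = u \<cdot> f" and w: "w \<in> PT X Y" "f = w \<cdot> a \<cdot> f"
    by (auto simp: cat_le_L_def P2_iff)
  then have "g = (u \<cdot> w) \<cdot> a \<cdot> f" by (metis pcomp_assoc)
  with u w show ?thesis unfolding sandwich_le_L_iff by (blast intro: pcomp_PT)
qed

lemma cat_le_J_imp_sandwich:
  assumes "f \<in> P3 X Y a" and "cat_le_J X Y X Y g f"
  shows "sg_le_J (PT X Y) (sandwich a) g f"
proof -
  from assms obtain s t u v where st: "s \<in> PT X X" "t \<in> PT Y Y" "g = s \<cdot> f \<cdot> t"
    and uv: "u \<in> PT X Y" "v \<in> PT X Y" "f = u \<cdot> a \<cdot> f \<cdot> a \<cdot> v"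
    unfolding cat_le_J_def P3_iff by blast
  then have "g = (s \<cdot> u) \<cdot> a \<cdot> f \<cdot> a \<cdot> (v \<cdot> t)" by (metis pcomp_assoc)
  with st uv show ?thesis unfolding sg_le_J_def sandwich_def by (blast intro: pcomp_PT)
qed

section \<open>The relations R, L and D of the sandwich semigroup\<close>

lemma sandwich_R_imp_P1:
  assumes "f \<in> PT X Y" and "sg_R (PT X Y) (sandwich a) g f" and "g \<noteq> f"
  shows "f \<in> P1 X Y a"
proof -
  \<comment> \<open>As \<open>g \<noteq> f\<close>, neither multiplier can be the adjoined
    identity.\<close>
  have "\<exists>u\<in>PT X Y. g = f \<cdot> a \<cdot> u" and "\<exists>v\<in>PT X Y. f = g \<cdot> a \<cdot> v"
    using assms(2,3) unfolding sg_R_def sandwich_le_R_iff by simp_all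
  then obtain u v where u: "u \<in> PT X Y" "g = f \<cdot> a \<cdot> u" and v: "v \<in> PT X Y" "f = g \<cdot> a \<cdot> v"
    by metis
  then have "f = f \<cdot> a \<cdot> (u \<cdot> a \<cdot> v)" by (metis pcomp_assoc)
  with assms(1) pcomp3_PT[OF u(1) v(1)] show ?thesis by (rule P1I)
qed

lemma sandwich_L_imp_P2:
  assumes "f \<in> PT X Y" and "sg_L (PT X Y) (sandwich a) g f" and "g \<noteq> f"
  shows "f \<in> P2 X Y a"
proof -
  have "\<exists>u\<in>PT X Y. g = u \<cdot> a \<cdot> f" and "\<exists>v\<in>PT X Y. f = v \<cdot> a \<cdot> g"
    using assms(2,3) unfolding sg_L_def sandwich_le_L_iff by simp_all
  then obtain u v where u: "u \<in> PT X Y" "g = u \<cdot> a \<cdot> f" and v: "v \<in> PT X Y" "f = v \<cdot> a \<cdot> g"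
    by metis
  then have "f = (v \<cdot> a \<cdot> u) \<cdot> a \<cdot> f" by (metis pcomp_assoc)
  with assms(1) pcomp3_PT[OF v(1) u(1)] show ?thesis by (rule P2I)
qed

text \<open>Distinct related elements both lie in \<open>P1\<close>, by
  \<open>sandwich_R_imp_P1\<close> used in both directions. Equality stays a separate disjunct
  because reflexivity also holds outside \<open>P1\<close>.\<close>

lemma sandwich_R_iff:
  assumes "g \<in> PT X Y" and "f \<in> PT X Y"
  shows "sg_R (PT X Y) (sandwich a) g f \<longleftrightarrow>
    g = f \<or> f \<in> P1 X Y a \<and> g \<in> P1 X Y a \<and> cat_R Y Y g f"
  using assms sandwich_R_imp_P1[of f g] sandwich_R_imp_P1[of g f]
  by (auto simp: sg_R_def cat_R_def sandwich_le_R_iff[of f f]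
      intro: sandwich_le_R_imp_cat cat_le_R_imp_sandwich)

lemma sandwich_L_iff:
  assumes "g \<in> PT X Y" and "f \<in> PT X Y"
  shows "sg_L (PT X Y) (sandwich a) g f \<longleftrightarrow>
    g = f \<or> f \<in> P2 X Y a \<and> g \<in> P2 X Y a \<and> cat_L X X g f"
  using assms sandwich_L_imp_P2[of f g] sandwich_L_imp_P2[of g f]
  by (auto simp: sg_L_def cat_L_def sandwich_le_L_iff[of f f]
      intro: sandwich_le_L_imp_cat cat_le_L_imp_sandwich)

lemma sandwich_D_iff:
  assumes g: "g \<in> PT X Y" and f: "f \<in> PT X Y"
  shows "sg_D (PT X Y) (sandwich a) g f \<longleftrightarrow>
    sg_R (PT X Y) (sandwich a) g f \<or> sg_L (PT X Y) (sandwich a) g f \<or>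
    f \<in> P X Y a \<and> g \<in> P X Y a \<and> cat_D X Y X Y g f"
    (is "?D \<longleftrightarrow> ?R \<or> ?L \<or> ?P")
proof
  assume ?D
  then obtain h where h: "h \<in> PT X Y" "sg_R (PT X Y) (sandwich a) g h"
    "sg_L (PT X Y) (sandwich a) h f" by (auto simp: sg_D_def)
  show "?R \<or> ?L \<or> ?P"
  proof (cases "g = h \<or> h = f")
    case False
    \<comment> \<open>Both links are now nontrivial. What is still missing for \<open>P\<close>,
      namely \<open>f\<close> in \<open>P1\<close> and \<open>g\<close> in \<open>P2\<close>, is
      passed on from \<open>h\<close> along L and R.\<close>
    with h g f have "h \<in> P1 X Y a" "g \<in> P1 X Y a" "cat_R Y Y g h"
      "f \<in> P2 X Y a" "h \<in> P2 X Y a" "cat_L X X h f"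
      by (auto simp: sandwich_R_iff sandwich_L_iff)
    with g f h(1) show ?thesis
      using P1_cat_L P2_cat_R by (auto simp: P_def cat_D_def)
  qed (use h in auto)
next
  assume "?R \<or> ?L \<or> ?P"
  then consider ?R | ?L | ?P by blast
  then show ?D
  proof cases
    case 1
    with f show ?thesis by (auto simp: sg_D_def sandwich_L_iff)
  next
    case 2
    with g show ?thesis by (auto simp: sg_D_def sandwich_R_iff)
  next
    case 3
    \<comment> \<open>The intermediate \<open>h\<close> of the category lies in \<open>P\<close>: it
      inherits \<open>P2\<close> from \<open>g\<close> along R and \<open>P1\<close> from
      \<open>f\<close> along L.\<close>
    then obtain h where "h \<in> PT X Y" "cat_R Y Y g h" "cat_L X X h f" by (auto simp: cat_D_def)
    with 3 g f show ?thesis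
      using P1_cat_L P2_cat_R by (auto simp: P_def sg_D_def sandwich_R_iff sandwich_L_iff)
  qed
qed

section \<open>The relation J of the sandwich semigroup\<close>

lemma P_subset_P3: "P X Y a \<subseteq> P3 X Y a"
proof
  fix f assume "f \<in> P X Y a"
  then obtain u v where "f \<in> PT X Y" "u \<in> PT X Y" "v \<in> PT X Y" "f = f \<cdot> a \<cdot> v" "f = u \<cdot> a \<cdot> f"
    by (auto simp: P_def P1_iff P2_iff)
  moreover from this have "f = u \<cdot> a \<cdot> f \<cdot> a \<cdot> v" by metis
  ultimately show "f \<in> P3 X Y a" by (blast intro: P3I)
qed

lemma sandwich_R_or_L_imp_J:
  assumes "sg_R (PT X Y) (sandwich a) g f \<or> sg_L (PT X Y) (sandwich a) g f"
  shows "sg_J (PT X Y) (sandwich a) g f"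
  using assms by (auto simp: sg_R_def sg_L_def sg_J_def sg_le_R_def sg_le_L_def sg_le_J_def)

text \<open>There are nine combinations of how \<open>g\<close> lies below \<open>f\<close> and
  \<open>f\<close> below \<open>g\<close>. Left with left gives L, right with right gives R, both
  excluded. In each other one, substituting the first equation into the second yields genuine
  multipliers on both sides of \<open>f\<close>.\<close>

lemma sandwich_J_imp_P3:
  assumes f: "f \<in> PT X Y" and J: "sg_J (PT X Y) (sandwich a) g f"
    and nR: "\<not> sg_R (PT X Y) (sandwich a) g f" and nL: "\<not> sg_L (PT X Y) (sandwich a) g f"
  shows "f \<in> P3 X Y a"
proof -
  have ne: "g \<noteq> f" using nR by (auto simp: sg_R_def sg_le_R_def)
  have gf: "sg_le_J (PT X Y) (sandwich a) g f" and fg: "sg_le_J (PT X Y) (sandwich a) f g"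
    using J by (auto simp: sg_J_def)
  note le = sandwich_le_L_iff sandwich_le_R_iff
  from gf show ?thesis
  proof (cases rule: sandwich_le_J_cases)
    case 1
    note le_gf = this
    then obtain s where s: "s \<in> PT X Y" "g = s \<cdot> a \<cdot> f" using ne unfolding le by blast
    from fg show ?thesis
    proof (cases rule: sandwich_le_J_cases)
      case 1
      with le_gf nL show ?thesis by (simp add: sg_L_def)
    next
      case 2
      then obtain q where q: "q \<in> PT X Y" "f = g \<cdot> a \<cdot> q" using ne unfolding le by blast
      with s have "f = s \<cdot> a \<cdot> f \<cdot> a \<cdot> q" by simp
      with f s(1) q(1) show ?thesis by (rule P3I)
    next
      case (3 p q)
      with s have "f = (p \<cdot> a \<cdot> s) \<cdot> a \<cdot> f \<cdot> a \<cdot> q" by (metis pcomp_assoc)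
      with f pcomp3_PT[OF 3(1) s(1)] 3(2) show ?thesis by (rule P3I)
    qed
  next
    case 2
    note le_gf = this
    then obtain t where t: "t \<in> PT X Y" "g = f \<cdot> a \<cdot> t" using ne unfolding le by blast
    from fg show ?thesis
    proof (cases rule: sandwich_le_J_cases)
      case 1
      then obtain p where p: "p \<in> PT X Y" "f = p \<cdot> a \<cdot> g" using ne unfolding le by blast
      with t have "f = p \<cdot> a \<cdot> f \<cdot> a \<cdot> t" by (metis pcomp_assoc)
      with f p(1) t(1) show ?thesis by (rule P3I)
    next
      case 2
      with le_gf nR show ?thesis by (simp add: sg_R_def)
    next
      case (3 p q)
      with t have "f = p \<cdot> a \<cdot> f \<cdot> a \<cdot> (t \<cdot> a \<cdot> q)" by (metis pcomp_assoc)
      with f 3(1) pcomp3_PT[OF t(1) 3(2)] show ?thesis by (rule P3I)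
    qed
  next
    case (3 s t)
    note st = this
    from fg show ?thesis
    proof (cases rule: sandwich_le_J_cases)
      case 1
      then obtain p where p: "p \<in> PT X Y" "f = p \<cdot> a \<cdot> g" using ne unfolding le by blast
      with st have "f = (p \<cdot> a \<cdot> s) \<cdot> a \<cdot> f \<cdot> a \<cdot> t" by (metis pcomp_assoc)
      with f pcomp3_PT[OF p(1) st(1)] st(2) show ?thesis by (rule P3I)
    next
      case 2
      then obtain q where q: "q \<in> PT X Y" "f = g \<cdot> a \<cdot> q" using ne unfolding le by blast
      with st have "f = s \<cdot> a \<cdot> f \<cdot> a \<cdot> (t \<cdot> a \<cdot> q)" by (metis pcomp_assoc)
      with f st(1) pcomp3_PT[OF st(2) q(1)] show ?thesis by (rule P3I)
    next
      case (3 p q)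
      with st have "f = (p \<cdot> a \<cdot> s) \<cdot> a \<cdot> f \<cdot> a \<cdot> (t \<cdot> a \<cdot> q)" by (metis pcomp_assoc)
      with f pcomp3_PT[OF 3(1) st(1)] pcomp3_PT[OF st(2) 3(2)] show ?thesis by (rule P3I)
    qed
  qed
qed

text \<open>First write \<open>f\<close> as a two-sided sandwich multiple of \<open>g\<close>, then
  substitute this into \<open>g = s \<cdot> f \<cdot> t\<close>.\<close>

lemma P3_sandwich_le_J:
  assumes g: "g \<in> PT X Y" and f: "f \<in> P3 X Y a" and gf: "cat_le_J X Y X Y g f"
    and fg: "sg_le_J (PT X Y) (sandwich a) f g"
  shows "g \<in> P3 X Y a"
proof -
  from f obtain u v where uv: "u \<in> PT X Y" "v \<in> PT X Y" "f = u \<cdot> a \<cdot> f \<cdot> a \<cdot> v"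
    unfolding P3_iff by blast
  \<comment> \<open>If \<open>fg\<close> is one-sided or an equality, the multipliers it lacks come
    from \<open>f = u \<cdot> a \<cdot> f \<cdot> a \<cdot> v\<close>.\<close>
  have "\<exists>x\<in>PT X Y. \<exists>y\<in>PT X Y. f = x \<cdot> a \<cdot> g \<cdot> a \<cdot> y"
    using fg
  proof (cases rule: sandwich_le_J_cases)
    case 1
    then consider "f = g" | p where "p \<in> PT X Y" "f = p \<cdot> a \<cdot> g"
      unfolding sandwich_le_L_iff by blast
    then show ?thesis
    proof cases
      case (2 p)
      with uv have "f = (u \<cdot> a \<cdot> p) \<cdot> a \<cdot> g \<cdot> a \<cdot> v" by (metis pcomp_assoc)
      with pcomp3_PT[OF uv(1) 2(1)] uv(2) show ?thesis by blast
    qed (use uv in metis)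
  next
    case 2
    then consider "f = g" | q where "q \<in> PT X Y" "f = g \<cdot> a \<cdot> q"
      unfolding sandwich_le_R_iff by blast
    then show ?thesis
    proof cases
      case (2 q)
      with uv have "f = u \<cdot> a \<cdot> g \<cdot> a \<cdot> (q \<cdot> a \<cdot> v)" by (metis pcomp_assoc)
      with uv(1) pcomp3_PT[OF 2(1) uv(2)] show ?thesis by blast
    qed (use uv in metis)
  qed blast
  then obtain x y where xy: "x \<in> PT X Y" "y \<in> PT X Y" "f = x \<cdot> a \<cdot> g \<cdot> a \<cdot> y" by blast
  from gf obtain s t where st: "s \<in> PT X X" "t \<in> PT Y Y" "g = s \<cdot> f \<cdot> t"
    unfolding cat_le_J_def by blast
  with xy have "g = (s \<cdot> x) \<cdot> a \<cdot> g \<cdot> a \<cdot> (y \<cdot> t)" by (metis pcomp_assoc)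
  with g pcomp_PT[OF st(1) xy(1)] pcomp_PT[OF xy(2) st(2)] show ?thesis by (rule P3I)
qed

lemma sandwich_J_iff_P3:
  assumes g: "g \<in> PT X Y" and f: "f \<in> P3 X Y a"
  shows "sg_J (PT X Y) (sandwich a) g f \<longleftrightarrow> g \<in> P3 X Y a \<and> cat_J X Y X Y g f"
proof -
  have "f \<in> PT X Y" using f by (simp add: P3_iff)
  with g f show ?thesis
    by (auto simp: sg_J_def cat_J_def
        intro: sandwich_le_J_imp_cat cat_le_J_imp_sandwich P3_sandwich_le_J)
qed

text \<open>Outside \<open>P3\<close>, hence outside \<open>P\<close>, both relations reduce to the
  union of R and L.\<close>

lemma sandwich_J_iff_D:
  assumes g: "g \<in> PT X Y" and f: "f \<in> PT X Y" and "f \<notin> P3 X Y a"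
  shows "sg_J (PT X Y) (sandwich a) g f \<longleftrightarrow> sg_D (PT X Y) (sandwich a) g f"
proof -
  have "f \<notin> P X Y a" using assms(3) P_subset_P3 by blast
  with assms show ?thesis
    using sandwich_J_imp_P3 sandwich_R_or_L_imp_J by (auto simp: sandwich_D_iff)
qed

section \<open>Idempotents and one-element groups\<close>

lemma idempotent_imp_P:
  assumes "f \<in> PT X Y" and "sandwich a f f = f"
  shows "f \<in> P X Y a"
proof -
  have "f = f \<cdot> a \<cdot> f" using assms(2) unfolding sandwich_def by (rule sym)
  \<comment> \<open>\<open>f\<close> itself is the witness for both \<open>P1\<close> and
    \<open>P2\<close>.\<close>
  with assms(1) show ?thesis unfolding P_def by (blast intro: P1I P2I)
qed

lemma singleton_group_imp_P:
  assumes "f \<in> PT X Y" and "is_group_under {f} (sandwich a)"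
  shows "f \<in> P X Y a"
proof -
  from assms(2) obtain e where "group \<lparr>carrier = {f}, mult = sandwich a, one = e\<rparr>"
    unfolding is_group_under_def by blast
  then interpret group "\<lparr>carrier = {f}, mult = sandwich a, one = e\<rparr>" .
  \<comment> \<open>Closure of a one-element carrier makes its element idempotent.\<close>
  have "sandwich a f f = f" using m_closed[of f f] by simp
  with assms(1) show ?thesis by (rule idempotent_imp_P)
qed

end

section \<open>From pointwise relations to the classes of \<open>f\<close>\<close>

theorem theorem2p13:
  fixes X :: "'a set" and Y :: "'b set"
    and a :: "'b \<rightharpoonup> 'a" and f :: "'a \<rightharpoonup> 'b"
  assumes "a \<in> PT Y X" and "f \<in> PT X Y"
  shows
    "((f \<in> P1 X Y a \<longrightarrow> sand_R_class X Y a f = cat_R_class X Y f \<inter> P1 X Y a) \<and>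
      (f \<notin> P1 X Y a \<longrightarrow> sand_R_class X Y a f = {f})) \<and>
     ((f \<in> P2 X Y a \<longrightarrow> sand_L_class X Y a f = cat_L_class X Y f \<inter> P2 X Y a) \<and>
      (f \<notin> P2 X Y a \<longrightarrow> sand_L_class X Y a f = {f})) \<and>
     ((f \<in> P X Y a \<longrightarrow> sand_H_class X Y a f = cat_H_class X Y f) \<and>
      (f \<notin> P X Y a \<longrightarrow> sand_H_class X Y a f = {f})) \<and>
     ((f \<in> P X Y a \<longrightarrow> sand_D_class X Y a f = cat_D_class X Y f \<inter> P X Y a) \<and>
      (f \<in> P2 X Y a - P1 X Y a \<longrightarrow> sand_D_class X Y a f = sand_L_class X Y a f) \<and>
      (f \<in> P1 X Y a - P2 X Y a \<longrightarrow> sand_D_class X Y a f = sand_R_class X Y a f) \<and>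
      (f \<notin> P1 X Y a \<union> P2 X Y a \<longrightarrow> sand_D_class X Y a f = {f})) \<and>
     ((f \<in> P3 X Y a \<longrightarrow> sand_J_class X Y a f = cat_J_class X Y f \<inter> P3 X Y a) \<and>
      (f \<notin> P3 X Y a \<longrightarrow> sand_J_class X Y a f = sand_D_class X Y a f)) \<and>
     (f \<notin> P X Y a \<longrightarrow>
        sand_H_class X Y a f = {f} \<and>
        \<not> is_group_under (sand_H_class X Y a f) (sandwich a))"
proof -
  note a = assms(1) and f = assms(2)
  note R = sandwich_R_iff[OF a _ f] and L = sandwich_L_iff[OF a _ f]
    and D = sandwich_D_iff[OF a _ f]
  note cls = sand_R_class_def sand_L_class_def sand_H_class_def sand_D_class_def sand_J_class_def
    cat_R_class_def cat_L_class_def cat_H_class_def cat_D_class_def cat_J_class_def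
  have refl: "cat_R Y Y f f" "cat_L X X f f"
    using cat_R_refl[OF f] cat_L_refl[OF f] .
  \<comment> \<open>The intermediate morphism is \<open>f\<close> here and \<open>g\<close> in
    \<open>LD\<close>.\<close>
  have RD: "cat_D X Y X Y g f" if "g \<in> PT X Y" "cat_R Y Y g f" for g
    using that refl f by (auto simp: cat_D_def)
  have LD: "cat_D X Y X Y g f" if "g \<in> PT X Y" "cat_L X X g f" for g
    using that cat_R_refl[OF that(1)] by (auto simp: cat_D_def)
  have P1: "g \<in> P1 X Y a \<longleftrightarrow> f \<in> P1 X Y a" if "g \<in> PT X Y" "cat_L X X g f" for g
    using P1_cat_L[OF a that(1) f that(2)] .
  have P2: "g \<in> P2 X Y a \<longleftrightarrow> f \<in> P2 X Y a" if "g \<in> PT X Y" "cat_R Y Y g f" for g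
    using P2_cat_R[OF a that(1) f that(2)] .
  have i: "f \<in> P1 X Y a \<longrightarrow> sand_R_class X Y a f = cat_R_class X Y f \<inter> P1 X Y a"
    "f \<notin> P1 X Y a \<longrightarrow> sand_R_class X Y a f = {f}"
    using R f refl by (auto simp: cls)
  have ii: "f \<in> P2 X Y a \<longrightarrow> sand_L_class X Y a f = cat_L_class X Y f \<inter> P2 X Y a"
    "f \<notin> P2 X Y a \<longrightarrow> sand_L_class X Y a f = {f}"
    using L f refl by (auto simp: cls)
  \<comment> \<open>No intersection with \<open>P\<close> is left: \<open>g\<close> shares
    membership in \<open>P1\<close> with \<open>f\<close> through L, and membership in
    \<open>P2\<close> through R.\<close>
  have H: "g \<in> sand_H_class X Y a f \<longleftrightarrow> g = f \<or> f \<in> P X Y a \<and> g \<in> cat_H_class X Y f" for g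
    using R[of g] L[of g] P1[of g] P2[of g] f by (auto simp: cls P_def)
  have iii: "f \<in> P X Y a \<longrightarrow> sand_H_class X Y a f = cat_H_class X Y f"
    "f \<notin> P X Y a \<longrightarrow> sand_H_class X Y a f = {f}"
    using f refl by (auto simp: H cat_H_class_def)
  have Dc: "sand_D_class X Y a f = sand_R_class X Y a f \<union> sand_L_class X Y a f \<union>
      (if f \<in> P X Y a then cat_D_class X Y f \<inter> P X Y a else {})"
    using D by (auto simp: cls)
  \<comment> \<open>For \<open>f\<close> in \<open>P\<close>, the first two members of the union
    \<open>Dc\<close> are absorbed by the third.\<close>
  have "sand_R_class X Y a f \<union> sand_L_class X Y a f \<subseteq> cat_D_class X Y f \<inter> P X Y a"
    if "f \<in> P X Y a"
  proof
    fix g assume "g \<in> sand_R_class X Y a f \<union> sand_L_class X Y a f"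
    then show "g \<in> cat_D_class X Y f \<inter> P X Y a"
      using that i ii RD[of g] LD[of g] P1[of g] P2[of g]
      by (auto simp: P_def cat_R_class_def cat_L_class_def cat_D_class_def)
  qed
  then have iv: "f \<in> P X Y a \<longrightarrow> sand_D_class X Y a f = cat_D_class X Y f \<inter> P X Y a"
    by (auto simp: Dc)
  have f_R: "f \<in> sand_R_class X Y a f" and f_L: "f \<in> sand_L_class X Y a f"
    using R L f by (auto simp: cls)
  have iv': "f \<in> P2 X Y a - P1 X Y a \<longrightarrow> sand_D_class X Y a f = sand_L_class X Y a f"
    "f \<in> P1 X Y a - P2 X Y a \<longrightarrow> sand_D_class X Y a f = sand_R_class X Y a f"
    "f \<notin> P1 X Y a \<union> P2 X Y a \<longrightarrow> sand_D_class X Y a f = {f}"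
    \<comment> \<open>Outside \<open>P1\<close> the R-class shrinks to \<open>{f}\<close>, which the
      L-class contains; dually outside \<open>P2\<close>.\<close>
    using i(2) ii(2) f_R f_L unfolding Dc P_def by auto
  have v: "f \<in> P3 X Y a \<longrightarrow> sand_J_class X Y a f = cat_J_class X Y f \<inter> P3 X Y a"
    "f \<notin> P3 X Y a \<longrightarrow> sand_J_class X Y a f = sand_D_class X Y a f"
    using sandwich_J_iff_P3[OF a] sandwich_J_iff_D[OF a _ f] by (auto simp: cls)
  have "f \<notin> P X Y a \<longrightarrow> \<not> is_group_under (sand_H_class X Y a f) (sandwich a)"
    using iii(2) singleton_group_imp_P[OF a f] by auto
  with i ii iii iv iv' v show ?thesis by simp
qed

end
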